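(* Let $X$ be a smooth projective variety and let $\mathcal{E}$ be a vector bundle on $X$. Let $D_1,D_2\subset X$ be effective Cartier divisors with $\mathrm{Supp}(D_1)\cap\mathrm{Supp}(D_2)=\varnothing$. For $i=1,2$ let $\mathcal{Q}_i$ be a nonzero coherent torsion sheaf supported on $D_i$ and let $\varphi_i:\mathcal{E}\to\mathcal{Q}_i$ be surjective $\mathcal{O}_X$-linear maps. Define $$V_1:=\ker(\varphi_1),\qquad V_2:=\ker(\varphi_2),$$ $$V_{12}:=\ker\big(V_1\xrightarrow{\ \overline{\varphi}_2\ }\mathcal{Q}_2\big),\qquad V_{21}:=\ker\big(V_2\xrightarrow{\ \overline{\varphi}_1\ }\mathcal{Q}_1\big),$$ where $\overline{\varphi}_j$ denotes the map induced by $\varphi_j$ on the relevant kernel (its restriction), and $$V:=\ker\big(\mathcal{E}\xrightarrow{(\varphi_1,\varphi_2)}\mathcal{Q}_1\oplus\mathcal{Q}_2\big).$$ Then: (1) As subsheaves of $\mathcal{E}$, $V_{12}=V_{21}=V$. In particular, the order of taking kernels (elementary transforms) with respect to $\varphi_1$ and $\varphi_2$ does not affect the resulting subsheaf of $\mathcal{E}$. (2) If, in addition, the three kernels $V_1,V_2,V$ are locally free, then the equalities in (1) are equalities of subbundles (i.e. locally free subsheaves) of $\mathcal{E}$.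
   Context: Varieties are integral projective schemes over an algebraically closed field of arbitrary characteristic; all sheaves are coherent $\mathcal{O}_X$-modules. An elementary transform of $\mathcal{E}$ along an effective divisor $D$ is the kernel of a surjection $\mathcal{E}\to\mathcal{T}$ onto a torsion sheaf $\mathcal{T}$ supported on $D$. Here "subbundle" means locally free subsheaf (the quotient need not be locally free). *)

theory Defs
  imports
    "HOL-Analysis.Function_Topology"
    "HOL-Library.Poly_Mapping"
    "HOL-Combinatorics.Permutations"
    "HOL-Computational_Algebra.Polynomial"
    "HOL-Algebra.Module"
    "HOL-Algebra.QuotRing"
begin

section \<open>Sheaves, germs and stalks\<close>

text \<open>
  A (pre)sheaf of sets on a topological space is given by its sets of sections \<open>C U\<close> and its
  restriction maps \<open>r U V\<close> from \<open>U\<close> to \<open>V\<close>.  Only the values at open sets \<open>V \<subseteq> U\<close> matter.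
  Open covers are arbitrary, so the empty cover of the empty set is included and \<open>C {}\<close> is a
  singleton for every sheaf.
\<close>

definition presheaf ::
  "'p topology \<Rightarrow> ('p set \<Rightarrow> 's set) \<Rightarrow> ('p set \<Rightarrow> 'p set \<Rightarrow> 's \<Rightarrow> 's) \<Rightarrow> bool" where
  "presheaf T C r \<longleftrightarrow>
     (\<forall>U V. openin T U \<longrightarrow> openin T V \<longrightarrow> V \<subseteq> U \<longrightarrow> r U V \<in> C U \<rightarrow> C V) \<and>
     (\<forall>U. openin T U \<longrightarrow> (\<forall>s \<in> C U. r U U s = s)) \<and>
     (\<forall>U V W. openin T U \<longrightarrow> openin T V \<longrightarrow> openin T W \<longrightarrow> W \<subseteq> V \<longrightarrow> V \<subseteq> U \<longrightarrow>
        (\<forall>s \<in> C U. r V W (r U V s) = r U W s))"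

definition sheaf ::
  "'p topology \<Rightarrow> ('p set \<Rightarrow> 's set) \<Rightarrow> ('p set \<Rightarrow> 'p set \<Rightarrow> 's \<Rightarrow> 's) \<Rightarrow> bool" where
  "sheaf T C r \<longleftrightarrow> presheaf T C r \<and>
     (\<forall>\<V> s. (\<forall>V \<in> \<V>. openin T V \<and> s V \<in> C V) \<longrightarrow>
        (\<forall>V \<in> \<V>. \<forall>W \<in> \<V>. r V (V \<inter> W) (s V) = r W (V \<inter> W) (s W)) \<longrightarrow>
        (\<exists>!t. t \<in> C (\<Union>\<V>) \<and> (\<forall>V \<in> \<V>. r (\<Union>\<V>) V t = s V)))"

definition germ ::
  "'p topology \<Rightarrow> ('p set \<Rightarrow> 's set) \<Rightarrow> ('p set \<Rightarrow> 'p set \<Rightarrow> 's \<Rightarrow> 's) \<Rightarrow>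
   'p \<Rightarrow> 'p set \<Rightarrow> 's \<Rightarrow> ('p set \<times> 's) set" where
  "germ T C r x U s =
     {(V, t). openin T V \<and> x \<in> V \<and> t \<in> C V \<and>
        (\<exists>W. openin T W \<and> x \<in> W \<and> W \<subseteq> U \<inter> V \<and> r U W s = r V W t)}"

definition stalk ::
  "'p topology \<Rightarrow> ('p set \<Rightarrow> 's set) \<Rightarrow> ('p set \<Rightarrow> 'p set \<Rightarrow> 's \<Rightarrow> 's) \<Rightarrow>
   'p \<Rightarrow> ('p set \<times> 's) set set" where
  "stalk T C r x = {germ T C r x U s | U s. openin T U \<and> x \<in> U \<and> s \<in> C U}"


section \<open>Ringed spaces\<close>

record ('p, 'a) rspace =
  base :: "'p topology"
  osec :: "'p set \<Rightarrow> 'a ring"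
  ores :: "'p set \<Rightarrow> 'p set \<Rightarrow> 'a \<Rightarrow> 'a"

abbreviation points :: "('p, 'a) rspace \<Rightarrow> 'p set" where
  "points X \<equiv> topspace (base X)"

abbreviation opn :: "('p, 'a) rspace \<Rightarrow> 'p set \<Rightarrow> bool" where
  "opn X U \<equiv> openin (base X) U"

abbreviation ogerm :: "('p, 'a) rspace \<Rightarrow> 'p \<Rightarrow> 'p set \<Rightarrow> 'a \<Rightarrow> ('p set \<times> 'a) set" where
  "ogerm X \<equiv> germ (base X) (\<lambda>U. carrier (osec X U)) (ores X)"

definition ringed_space :: "('p, 'a) rspace \<Rightarrow> bool" where
  "ringed_space X \<longleftrightarrow>
     sheaf (base X) (\<lambda>U. carrier (osec X U)) (ores X) \<and>
     (\<forall>U. opn X U \<longrightarrow> cring (osec X U)) \<and>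
     (\<forall>U V. opn X U \<longrightarrow> opn X V \<longrightarrow> V \<subseteq> U \<longrightarrow> ores X U V \<in> ring_hom (osec X U) (osec X V))"

definition open_subspace :: "('p, 'a) rspace \<Rightarrow> 'p set \<Rightarrow> ('p, 'a) rspace" where
  "open_subspace X U = X\<lparr>base := subtopology (base X) U\<rparr>"

definition preim :: "('p, 'a) rspace \<Rightarrow> ('p \<Rightarrow> 'q) \<Rightarrow> 'q set \<Rightarrow> 'p set" where
  "preim X f V = {x \<in> points X. f x \<in> V}"

definition unit_at :: "('p, 'a) rspace \<Rightarrow> 'p \<Rightarrow> 'p set \<Rightarrow> 'a \<Rightarrow> bool" where
  "unit_at X x U s \<longleftrightarrow>
     (\<exists>W. opn X W \<and> x \<in> W \<and> W \<subseteq> U \<and> ores X U W s \<in> Units (osec X W))"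

text \<open>
  Morphisms \<open>(f, f\<^sup>#)\<close> of ringed spaces; \<open>h V\<close> is the component
  \<open>\<O>\<^sub>Y(V) \<rightarrow> \<O>\<^sub>X(f\<^sup>-\<^sup>1 V)\<close> of \<open>f\<^sup>#\<close>.
  In a morphism of locally ringed spaces the maps on stalks are local homomorphisms, i.e. they
  reflect units.
\<close>

definition rs_morphism ::
  "('p, 'a) rspace \<Rightarrow> ('q, 'b) rspace \<Rightarrow> ('p \<Rightarrow> 'q) \<Rightarrow> ('q set \<Rightarrow> 'b \<Rightarrow> 'a) \<Rightarrow> bool" where
  "rs_morphism X Y f h \<longleftrightarrow>
     continuous_map (base X) (base Y) f \<and>
     (\<forall>V. opn Y V \<longrightarrow> h V \<in> ring_hom (osec Y V) (osec X (preim X f V))) \<and>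
     (\<forall>V W. opn Y V \<longrightarrow> opn Y W \<longrightarrow> W \<subseteq> V \<longrightarrow>
        (\<forall>s \<in> carrier (osec Y V).
           h W (ores Y V W s) = ores X (preim X f V) (preim X f W) (h V s)))"

definition lrs_morphism ::
  "('p, 'a) rspace \<Rightarrow> ('q, 'b) rspace \<Rightarrow> ('p \<Rightarrow> 'q) \<Rightarrow> ('q set \<Rightarrow> 'b \<Rightarrow> 'a) \<Rightarrow> bool" where
  "lrs_morphism X Y f h \<longleftrightarrow> rs_morphism X Y f h \<and>
     (\<forall>V s x. opn Y V \<longrightarrow> s \<in> carrier (osec Y V) \<longrightarrow> x \<in> preim X f V \<longrightarrow>
        unit_at X x (preim X f V) (h V s) \<longrightarrow> unit_at Y (f x) V s)"

definition rs_isomorphism ::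
  "('p, 'a) rspace \<Rightarrow> ('q, 'b) rspace \<Rightarrow> ('p \<Rightarrow> 'q) \<Rightarrow> ('q set \<Rightarrow> 'b \<Rightarrow> 'a) \<Rightarrow> bool" where
  "rs_isomorphism X Y f h \<longleftrightarrow> rs_morphism X Y f h \<and>
     homeomorphic_map (base X) (base Y) f \<and>
     (\<forall>V. opn Y V \<longrightarrow> h V \<in> ring_iso (osec Y V) (osec X (preim X f V)))"

definition closed_immersion ::
  "('p, 'a) rspace \<Rightarrow> ('q, 'b) rspace \<Rightarrow> ('p \<Rightarrow> 'q) \<Rightarrow> ('q set \<Rightarrow> 'b \<Rightarrow> 'a) \<Rightarrow> bool" where
  "closed_immersion X Y f h \<longleftrightarrow> lrs_morphism X Y f h \<and>
     embedding_map (base X) (base Y) f \<and> closedin (base Y) (f ` points X) \<and>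
     (\<forall>V t y. opn Y V \<longrightarrow> t \<in> carrier (osec X (preim X f V)) \<longrightarrow> y \<in> V \<longrightarrow>
        (\<exists>W s. opn Y W \<and> y \<in> W \<and> W \<subseteq> V \<and> s \<in> carrier (osec Y W) \<and>
           h W s = ores X (preim X f V) (preim X f W) t))"


section \<open>Spec and Proj\<close>

text \<open>
  The class of the fraction \<open>a/f\<close> in the localization of \<open>A\<close> at the prime \<open>P\<close>.
  The sum and product of two classes are written as unions over all representatives; all
  the sets in such a union coincide.
\<close>

definition frac :: "'a ring \<Rightarrow> 'a set \<Rightarrow> 'a \<Rightarrow> 'a \<Rightarrow> ('a \<times> 'a) set" where
  "frac A P a f =
     {(b, g). b \<in> carrier A \<and> g \<in> carrier A - P \<and>
        (\<exists>u \<in> carrier A - P. u \<otimes>\<^bsub>A\<^esub> ((a \<otimes>\<^bsub>A\<^esub> g) \<ominus>\<^bsub>A\<^esub> (b \<otimes>\<^bsub>A\<^esub> f)) = \<zero>\<^bsub>A\<^esub>)}"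

definition localization :: "'a ring \<Rightarrow> 'a set \<Rightarrow> ('a \<times> 'a) set ring" where
  "localization A P =
     \<lparr>carrier = {frac A P a f | a f. a \<in> carrier A \<and> f \<in> carrier A - P},
      monoid.mult = (\<lambda>x y. \<Union>(a, f) \<in> x. \<Union>(b, g) \<in> y. frac A P (a \<otimes>\<^bsub>A\<^esub> b) (f \<otimes>\<^bsub>A\<^esub> g)),
      one = frac A P \<one>\<^bsub>A\<^esub> \<one>\<^bsub>A\<^esub>,
      ring.zero = frac A P \<zero>\<^bsub>A\<^esub> \<one>\<^bsub>A\<^esub>,
      add = (\<lambda>x y. \<Union>(a, f) \<in> x. \<Union>(b, g) \<in> y.
               frac A P ((a \<otimes>\<^bsub>A\<^esub> g) \<oplus>\<^bsub>A\<^esub> (b \<otimes>\<^bsub>A\<^esub> f)) (f \<otimes>\<^bsub>A\<^esub> g))\<rparr>"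

text \<open>
  The space with underlying topology \<open>T\<close> (whose points are primes of \<open>A\<close>) on which a section over
  \<open>V\<close> is a function assigning to each \<open>P \<in> V\<close> an element of the localization at \<open>P\<close>, locally given
  by a single fraction \<open>a/f\<close> with \<open>(a, f) \<in> F\<close>.  Sections are \<^const>\<open>undefined\<close> outside \<open>V\<close>, so
  that they are equal iff they agree on \<open>V\<close>.
\<close>

definition frac_space ::
  "'a ring \<Rightarrow> ('a \<times> 'a) set \<Rightarrow> 'a set topology \<Rightarrow> ('a set, 'a set \<Rightarrow> ('a \<times> 'a) set) rspace" where
  "frac_space A F T =
     \<lparr>base = T,
      osec = (\<lambda>V.
        \<lparr>carrier = {s \<in> extensional V. \<forall>P \<in> V. \<exists>W a f. openin T W \<and> P \<in> W \<and> W \<subseteq> V \<and> (a, f) \<in> F \<and>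
                      (\<forall>Q \<in> W. f \<notin> Q \<and> s Q = frac A Q a f)},
         monoid.mult = (\<lambda>s t. \<lambda>P \<in> V. s P \<otimes>\<^bsub>localization A P\<^esub> t P),
         one = (\<lambda>P \<in> V. \<one>\<^bsub>localization A P\<^esub>),
         ring.zero = (\<lambda>P \<in> V. \<zero>\<^bsub>localization A P\<^esub>),
         add = (\<lambda>s t. \<lambda>P \<in> V. s P \<oplus>\<^bsub>localization A P\<^esub> t P)\<rparr>),
      ores = (\<lambda>U V s. restrict s V)\<rparr>"

definition Spec :: "'a ring \<Rightarrow> ('a set, 'a set \<Rightarrow> ('a \<times> 'a) set) rspace" where
  "Spec A = frac_space A (carrier A \<times> carrier A)
     (topology_generated_by {{P. primeideal P A \<and> f \<notin> P} | f. f \<in> carrier A})"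

text \<open>
  The ring \<open>k[x\<^sub>0, \<dots>, x\<^sub>n\<^sub>-\<^sub>1]\<close>, as the finitely supported functions from exponent vectors
  (themselves finitely supported) to \<open>k\<close>.
\<close>

type_synonym 'k mpol = "(nat \<Rightarrow>\<^sub>0 nat) \<Rightarrow>\<^sub>0 'k"

definition type_ring :: "'a::comm_ring_1 ring" where
  "type_ring = \<lparr>carrier = UNIV, monoid.mult = (*), one = 1, ring.zero = 0, add = (+)\<rparr>"

definition poly_ring :: "nat \<Rightarrow> 'k::field mpol ring" where
  "poly_ring n =
     type_ring\<lparr>carrier := {p :: 'k mpol. \<forall>m \<in> Poly_Mapping.keys p. Poly_Mapping.keys m \<subseteq> {..<n}}\<rparr>"

definition const_poly :: "'k::field \<Rightarrow> 'k mpol" where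
  "const_poly c = Poly_Mapping.single 0 c"

definition mon_degree :: "(nat \<Rightarrow>\<^sub>0 nat) \<Rightarrow> nat" where
  "mon_degree m = (\<Sum>i \<in> Poly_Mapping.keys m. Poly_Mapping.lookup m i)"

definition hom_part :: "nat \<Rightarrow> 'k::field mpol \<Rightarrow> 'k mpol" where
  "hom_part d p =
     (\<Sum>m \<in> {m \<in> Poly_Mapping.keys p. mon_degree m = d}. Poly_Mapping.single m (Poly_Mapping.lookup p m))"

definition homogeneous :: "nat \<Rightarrow> 'k::field mpol \<Rightarrow> bool" where
  "homogeneous d p \<longleftrightarrow> (\<forall>m \<in> Poly_Mapping.keys p. mon_degree m = d)"

definition homogeneous_ideal :: "'k::field mpol set \<Rightarrow> bool" where
  "homogeneous_ideal I \<longleftrightarrow> (\<forall>p \<in> I. \<forall>d. hom_part d p \<in> I)"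

definition proj_points :: "nat \<Rightarrow> 'k::field mpol set set" where
  "proj_points n = {P. primeideal P (poly_ring (n + 1)) \<and> homogeneous_ideal P \<and>
     \<not> {p \<in> carrier (poly_ring (n + 1)). Poly_Mapping.lookup p 0 = 0} \<subseteq> P}"

text \<open>
  Projective \<open>n\<close>-space is Proj of \<open>k[x\<^sub>0, \<dots>, x\<^sub>n]\<close>.  The homogeneous localization at \<open>P\<close>
  is regarded as a subring of the full localization at \<open>P\<close>.
\<close>

definition proj_space ::
  "nat \<Rightarrow> ('k::field mpol set, 'k mpol set \<Rightarrow> ('k mpol \<times> 'k mpol) set) rspace" where
  "proj_space n = frac_space (poly_ring (n + 1))
     {(a, f). a \<in> carrier (poly_ring (n + 1)) \<and> f \<in> carrier (poly_ring (n + 1)) \<and>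
        (\<exists>d. homogeneous d a \<and> homogeneous d f)}
     (topology_generated_by {{P \<in> proj_points n. f \<notin> P} | f.
        f \<in> carrier (poly_ring (n + 1)) \<and> (\<exists>d. homogeneous d f)})"

definition proj_const ::
  "nat \<Rightarrow> 'k::field \<Rightarrow> 'k mpol set \<Rightarrow> ('k mpol \<times> 'k mpol) set" where
  "proj_const n c = (\<lambda>P \<in> proj_points n. frac (poly_ring (n + 1)) P (const_poly c) 1)"


section \<open>Varieties\<close>

text \<open>
  Any ring \<open>A\<close> with \<open>X \<cong> Spec A\<close> is isomorphic to the ring of global sections of \<open>X\<close>, so it is no
  restriction that \<open>A\<close> ranges over rings on the type of sections of \<open>X\<close>.
\<close>

definition affine_scheme :: "('p, 'a) rspace \<Rightarrow> bool" where
  "affine_scheme X \<longleftrightarrow> ringed_space X \<and>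
     (\<exists>(A :: 'a ring) f h. cring A \<and> rs_isomorphism X (Spec A) f h)"

definition scheme :: "('p, 'a) rspace \<Rightarrow> bool" where
  "scheme X \<longleftrightarrow> ringed_space X \<and>
     (\<forall>x \<in> points X. \<exists>U. opn X U \<and> x \<in> U \<and> affine_scheme (open_subspace X U))"

definition integral_scheme :: "('p, 'a) rspace \<Rightarrow> bool" where
  "integral_scheme X \<longleftrightarrow> scheme X \<and> points X \<noteq> {} \<and>
     (\<forall>U. opn X U \<longrightarrow> U \<noteq> {} \<longrightarrow> domain (osec X U))"

text \<open>
  A scheme over \<open>k\<close> is a scheme with a ring homomorphism \<open>\<kappa> : k \<rightarrow> \<O>\<^sub>X(X)\<close>; this is
  the same as a morphism to \<open>Spec k\<close>.
\<close>

definition scheme_over :: "('p, 'a) rspace \<Rightarrow> ('k::field \<Rightarrow> 'a) \<Rightarrow> bool" where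
  "scheme_over X \<kappa> \<longleftrightarrow> scheme X \<and> \<kappa> \<in> ring_hom type_ring (osec X (points X))"

definition projective_over :: "('p, 'a) rspace \<Rightarrow> ('k::field \<Rightarrow> 'a) \<Rightarrow> bool" where
  "projective_over X \<kappa> \<longleftrightarrow> scheme_over X \<kappa> \<and>
     (\<exists>n f h. closed_immersion X (proj_space n :: ('k mpol set, _) rspace) f h \<and>
        (\<forall>c. h (proj_points n) (proj_const n c) = \<kappa> c))"

text \<open>Smoothness over \<open>k\<close> is defined by the Jacobian criterion: \<open>X\<close> is locally of the form
  \<open>Spec k[x\<^sub>0, \<dots>, x\<^sub>n\<^sub>-\<^sub>1]/(p\<^sub>0, \<dots>, p\<^sub>c\<^sub>-\<^sub>1)\<close> where the Jacobian minor of the \<open>p\<^sub>i\<close> with respect to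
  the first \<open>c\<close> variables is a unit.\<close>

definition pdiff :: "nat \<Rightarrow> 'k::field mpol \<Rightarrow> 'k mpol" where
  "pdiff i p = (\<Sum>m \<in> Poly_Mapping.keys p.
     Poly_Mapping.single (m - Poly_Mapping.single i 1)
       (of_nat (Poly_Mapping.lookup m i) * Poly_Mapping.lookup p m))"

definition jacobian_minor :: "nat \<Rightarrow> (nat \<Rightarrow> 'k::field mpol) \<Rightarrow> 'k mpol" where
  "jacobian_minor c p =
     (\<Sum>\<sigma> \<in> {\<sigma>. \<sigma> permutes {..<c}}. of_int (sign \<sigma>) * (\<Prod>i<c. pdiff (\<sigma> i) (p i)))"

definition smooth_over :: "('p, 'a) rspace \<Rightarrow> ('k::field \<Rightarrow> 'a) \<Rightarrow> bool" where
  "smooth_over X \<kappa> \<longleftrightarrow> scheme_over X \<kappa> \<and>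
     (\<forall>x \<in> points X. \<exists>U n c (p :: nat \<Rightarrow> 'k mpol) \<theta>.
        opn X U \<and> x \<in> U \<and> affine_scheme (open_subspace X U) \<and> c \<le> n \<and>
        (\<forall>i<c. p i \<in> carrier (poly_ring n)) \<and>
        \<theta> \<in> ring_hom (poly_ring n) (osec X U) \<and>
        (\<forall>a. \<theta> (const_poly a) = ores X (points X) U (\<kappa> a)) \<and>
        \<theta> ` carrier (poly_ring n) = carrier (osec X U) \<and>
        a_kernel (poly_ring n) (osec X U) \<theta> = Idl\<^bsub>poly_ring n\<^esub> (p ` {..<c}) \<and>
        \<theta> (jacobian_minor c p) \<in> Units (osec X U))"

definition smooth_projective_variety ::
  "('p, 'a) rspace \<Rightarrow> ('k::alg_closed_field \<Rightarrow> 'a) \<Rightarrow> bool" where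
  "smooth_projective_variety X \<kappa> \<longleftrightarrow>
     integral_scheme X \<and> projective_over X \<kappa> \<and> smooth_over X \<kappa>"


section \<open>Sheaves of modules\<close>

record ('p, 'a, 'm) msheaf =
  sec :: "'p set \<Rightarrow> ('a, 'm) module"
  mres :: "'p set \<Rightarrow> 'p set \<Rightarrow> 'm \<Rightarrow> 'm"

abbreviation mcarrier :: "('p, 'a, 'm) msheaf \<Rightarrow> 'p set \<Rightarrow> 'm set" where
  "mcarrier F U \<equiv> carrier (sec F U)"

abbreviation mgerm ::
  "('p, 'a) rspace \<Rightarrow> ('p, 'a, 'm) msheaf \<Rightarrow> 'p \<Rightarrow> 'p set \<Rightarrow> 'm \<Rightarrow> ('p set \<times> 'm) set" where
  "mgerm X F \<equiv> germ (base X) (mcarrier F) (mres F)"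

abbreviation mstalk ::
  "('p, 'a) rspace \<Rightarrow> ('p, 'a, 'm) msheaf \<Rightarrow> 'p \<Rightarrow> ('p set \<times> 'm) set set" where
  "mstalk X F \<equiv> stalk (base X) (mcarrier F) (mres F)"

definition module_sheaf :: "('p, 'a) rspace \<Rightarrow> ('p, 'a, 'm) msheaf \<Rightarrow> bool" where
  "module_sheaf X F \<longleftrightarrow>
     sheaf (base X) (mcarrier F) (mres F) \<and>
     (\<forall>U. opn X U \<longrightarrow> module (osec X U) (sec F U)) \<and>
     (\<forall>U V. opn X U \<longrightarrow> opn X V \<longrightarrow> V \<subseteq> U \<longrightarrow>
        (\<forall>s \<in> mcarrier F U. \<forall>t \<in> mcarrier F U.
           mres F U V (s \<oplus>\<^bsub>sec F U\<^esub> t) = mres F U V s \<oplus>\<^bsub>sec F V\<^esub> mres F U V t) \<and>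
        (\<forall>a \<in> carrier (osec X U). \<forall>s \<in> mcarrier F U.
           mres F U V (a \<odot>\<^bsub>sec F U\<^esub> s) = ores X U V a \<odot>\<^bsub>sec F V\<^esub> mres F U V s))"

definition module_sheaf_hom ::
  "('p, 'a) rspace \<Rightarrow> ('p, 'a, 'm) msheaf \<Rightarrow> ('p, 'a, 'n) msheaf \<Rightarrow> ('p set \<Rightarrow> 'm \<Rightarrow> 'n) \<Rightarrow> bool" where
  "module_sheaf_hom X F G \<phi> \<longleftrightarrow>
     (\<forall>U. opn X U \<longrightarrow>
        \<phi> U \<in> mcarrier F U \<rightarrow> mcarrier G U \<and>
        (\<forall>s \<in> mcarrier F U. \<forall>t \<in> mcarrier F U.
           \<phi> U (s \<oplus>\<^bsub>sec F U\<^esub> t) = \<phi> U s \<oplus>\<^bsub>sec G U\<^esub> \<phi> U t) \<and>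
        (\<forall>a \<in> carrier (osec X U). \<forall>s \<in> mcarrier F U.
           \<phi> U (a \<odot>\<^bsub>sec F U\<^esub> s) = a \<odot>\<^bsub>sec G U\<^esub> \<phi> U s)) \<and>
     (\<forall>U V. opn X U \<longrightarrow> opn X V \<longrightarrow> V \<subseteq> U \<longrightarrow>
        (\<forall>s \<in> mcarrier F U. \<phi> V (mres F U V s) = mres G U V (\<phi> U s)))"

text \<open>A map of sheaves is surjective iff it is surjective on stalks.\<close>

definition module_sheaf_epi ::
  "('p, 'a) rspace \<Rightarrow> ('p, 'a, 'm) msheaf \<Rightarrow> ('p, 'a, 'n) msheaf \<Rightarrow> ('p set \<Rightarrow> 'm \<Rightarrow> 'n) \<Rightarrow> bool" where
  "module_sheaf_epi X F G \<phi> \<longleftrightarrow> module_sheaf_hom X F G \<phi> \<and>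
     (\<forall>x \<in> points X.
        {mgerm X G x U (\<phi> U s) | U s. opn X U \<and> x \<in> U \<and> s \<in> mcarrier F U} = mstalk X G x)"

definition module_sheaf_iso ::
  "('p, 'a) rspace \<Rightarrow> ('p, 'a, 'm) msheaf \<Rightarrow> ('p, 'a, 'n) msheaf \<Rightarrow> ('p set \<Rightarrow> 'm \<Rightarrow> 'n) \<Rightarrow> bool" where
  "module_sheaf_iso X F G \<phi> \<longleftrightarrow> module_sheaf_hom X F G \<phi> \<and>
     (\<forall>U. opn X U \<longrightarrow> bij_betw (\<phi> U) (mcarrier F U) (mcarrier G U))"

text \<open>The multiplication and unit fields of a module record play no role in being a module.\<close>

definition free_sheaf :: "('p, 'a) rspace \<Rightarrow> nat \<Rightarrow> ('p, 'a, nat \<Rightarrow> 'a) msheaf" where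
  "free_sheaf X n =
     \<lparr>sec = (\<lambda>U.
        \<lparr>carrier = {..<n} \<rightarrow>\<^sub>E carrier (osec X U),
         monoid.mult = undefined,
         one = undefined,
         ring.zero = (\<lambda>i \<in> {..<n}. \<zero>\<^bsub>osec X U\<^esub>),
         add = (\<lambda>s t. \<lambda>i \<in> {..<n}. s i \<oplus>\<^bsub>osec X U\<^esub> t i),
         smult = (\<lambda>a s. \<lambda>i \<in> {..<n}. a \<otimes>\<^bsub>osec X U\<^esub> s i)\<rparr>),
      mres = (\<lambda>U V s. \<lambda>i \<in> {..<n}. ores X U V (s i))\<rparr>"

definition direct_sum ::
  "('p, 'a, 'm) msheaf \<Rightarrow> ('p, 'a, 'n) msheaf \<Rightarrow> ('p, 'a, 'm \<times> 'n) msheaf" where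
  "direct_sum F G =
     \<lparr>sec = (\<lambda>U.
        \<lparr>carrier = mcarrier F U \<times> mcarrier G U,
         monoid.mult = undefined,
         one = undefined,
         ring.zero = (\<zero>\<^bsub>sec F U\<^esub>, \<zero>\<^bsub>sec G U\<^esub>),
         add = (\<lambda>(s, t) (s', t'). (s \<oplus>\<^bsub>sec F U\<^esub> s', t \<oplus>\<^bsub>sec G U\<^esub> t')),
         smult = (\<lambda>a (s, t). (a \<odot>\<^bsub>sec F U\<^esub> s, a \<odot>\<^bsub>sec G U\<^esub> t))\<rparr>),
      mres = (\<lambda>U V (s, t). (mres F U V s, mres G U V t))\<rparr>"

definition pair_hom ::
  "('p set \<Rightarrow> 'm \<Rightarrow> 'n1) \<Rightarrow> ('p set \<Rightarrow> 'm \<Rightarrow> 'n2) \<Rightarrow> 'p set \<Rightarrow> 'm \<Rightarrow> 'n1 \<times> 'n2" where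
  "pair_hom \<phi> \<psi> = (\<lambda>U s. (\<phi> U s, \<psi> U s))"

definition ker_sheaf ::
  "('p, 'a, 'm) msheaf \<Rightarrow> ('p, 'a, 'n) msheaf \<Rightarrow> ('p set \<Rightarrow> 'm \<Rightarrow> 'n) \<Rightarrow> ('p, 'a, 'm) msheaf" where
  "ker_sheaf F G \<phi> =
     F\<lparr>sec := (\<lambda>U. (sec F U)\<lparr>carrier := {s \<in> mcarrier F U. \<phi> U s = \<zero>\<^bsub>sec G U\<^esub>}\<rparr>)\<rparr>"

definition restrict_hom ::
  "('p, 'a, 'm) msheaf \<Rightarrow> ('p set \<Rightarrow> 'm \<Rightarrow> 'n) \<Rightarrow> 'p set \<Rightarrow> 'm \<Rightarrow> 'n" where
  "restrict_hom F \<phi> = (\<lambda>U. restrict (\<phi> U) (mcarrier F U))"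

definition subsheaf ::
  "('p, 'a) rspace \<Rightarrow> ('p, 'a, 'm) msheaf \<Rightarrow> ('p, 'a, 'm) msheaf \<Rightarrow> bool" where
  "subsheaf X G F \<longleftrightarrow> module_sheaf X G \<and> mres G = mres F \<and>
     (\<forall>U. opn X U \<longrightarrow>
        submodule (mcarrier G U) (osec X U) (sec F U) \<and>
        sec G U = (sec F U)\<lparr>carrier := mcarrier G U\<rparr>)"

text \<open>
  In the following definitions the restriction of a sheaf to an open subset \<open>U\<close> is the same
  record, considered over \<^term>\<open>open_subspace X U\<close>.
\<close>

definition locally_free :: "('p, 'a) rspace \<Rightarrow> ('p, 'a, 'm) msheaf \<Rightarrow> bool" where
  "locally_free X F \<longleftrightarrow> module_sheaf X F \<and>
     (\<forall>x \<in> points X. \<exists>U n \<phi>. opn X U \<and> x \<in> U \<and>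
        module_sheaf_iso (open_subspace X U) (free_sheaf (open_subspace X U) n) F \<phi>)"

abbreviation vector_bundle :: "('p, 'a) rspace \<Rightarrow> ('p, 'a, 'm) msheaf \<Rightarrow> bool" where
  "vector_bundle \<equiv> locally_free"

definition subbundle ::
  "('p, 'a) rspace \<Rightarrow> ('p, 'a, 'm) msheaf \<Rightarrow> ('p, 'a, 'm) msheaf \<Rightarrow> bool" where
  "subbundle X G F \<longleftrightarrow> subsheaf X G F \<and> locally_free X G"

definition finite_type :: "('p, 'a) rspace \<Rightarrow> ('p, 'a, 'm) msheaf \<Rightarrow> bool" where
  "finite_type X F \<longleftrightarrow>
     (\<forall>x \<in> points X. \<exists>U n \<phi>. opn X U \<and> x \<in> U \<and>
        module_sheaf_epi (open_subspace X U) (free_sheaf (open_subspace X U) n) F \<phi>)"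

definition coherent :: "('p, 'a) rspace \<Rightarrow> ('p, 'a, 'm) msheaf \<Rightarrow> bool" where
  "coherent X F \<longleftrightarrow> module_sheaf X F \<and> finite_type X F \<and>
     (\<forall>U n \<phi>. opn X U \<longrightarrow>
        module_sheaf_hom (open_subspace X U) (free_sheaf (open_subspace X U) n) F \<phi> \<longrightarrow>
        finite_type (open_subspace X U) (ker_sheaf (free_sheaf (open_subspace X U) n) F \<phi>))"

definition zero_sheaf :: "('p, 'a) rspace \<Rightarrow> ('p, 'a, 'm) msheaf \<Rightarrow> bool" where
  "zero_sheaf X F \<longleftrightarrow> (\<forall>U. opn X U \<longrightarrow> mcarrier F U = {\<zero>\<^bsub>sec F U\<^esub>})"

text \<open>On an integral scheme: every stalk is a torsion module over the local ring, a domain.\<close>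

definition torsion_sheaf :: "('p, 'a) rspace \<Rightarrow> ('p, 'a, 'm) msheaf \<Rightarrow> bool" where
  "torsion_sheaf X F \<longleftrightarrow>
     (\<forall>x U s. opn X U \<longrightarrow> x \<in> U \<longrightarrow> s \<in> mcarrier F U \<longrightarrow>
        (\<exists>V a. opn X V \<and> x \<in> V \<and> V \<subseteq> U \<and> a \<in> carrier (osec X V) \<and>
           ogerm X x V a \<noteq> ogerm X x V \<zero>\<^bsub>osec X V\<^esub> \<and>
           mgerm X F x V (a \<odot>\<^bsub>sec F V\<^esub> mres F U V s) = mgerm X F x V \<zero>\<^bsub>sec F V\<^esub>))"

definition sheaf_support :: "('p, 'a) rspace \<Rightarrow> ('p, 'a, 'm) msheaf \<Rightarrow> 'p set" where
  "sheaf_support X F =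
     {x \<in> points X. mstalk X F x \<noteq> {mgerm X F x (points X) \<zero>\<^bsub>sec F (points X)\<^esub>}}"


section \<open>Effective Cartier divisors\<close>

text \<open>
  An effective Cartier divisor is represented by its ideal sheaf \<open>D \<subseteq> \<O>\<^sub>X\<close>, which is
  locally generated by a single nonzerodivisor.  Its support consists of the points \<open>x\<close> with
  \<open>D\<^sub>x \<noteq> \<O>\<^sub>X\<^sub>,\<^sub>x\<close>, i.e. those without a neighbourhood \<open>U\<close> with \<open>1 \<in> D(U)\<close>.
\<close>

definition effective_cartier :: "('p, 'a) rspace \<Rightarrow> ('p set \<Rightarrow> 'a set) \<Rightarrow> bool" where
  "effective_cartier X D \<longleftrightarrow>
     sheaf (base X) D (ores X) \<and>
     (\<forall>U. opn X U \<longrightarrow> ideal (D U) (osec X U)) \<and>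
     (\<forall>x \<in> points X. \<exists>U f. opn X U \<and> x \<in> U \<and> f \<in> carrier (osec X U) \<and>
        (\<forall>V. opn X V \<longrightarrow> V \<subseteq> U \<longrightarrow>
           D V = PIdl\<^bsub>osec X V\<^esub> (ores X U V f) \<and>
           (\<forall>g \<in> carrier (osec X V). g \<otimes>\<^bsub>osec X V\<^esub> ores X U V f = \<zero>\<^bsub>osec X V\<^esub> \<longrightarrow>
              g = \<zero>\<^bsub>osec X V\<^esub>)))"

definition divisor_support :: "('p, 'a) rspace \<Rightarrow> ('p set \<Rightarrow> 'a set) \<Rightarrow> 'p set" where
  "divisor_support X D =
     {x \<in> points X. \<forall>U. opn X U \<longrightarrow> x \<in> U \<longrightarrow> \<one>\<^bsub>osec X U\<^esub> \<notin> D U}"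

definition supported_on ::
  "('p, 'a) rspace \<Rightarrow> ('p, 'a, 'm) msheaf \<Rightarrow> ('p set \<Rightarrow> 'a set) \<Rightarrow> bool" where
  "supported_on X F D \<longleftrightarrow> sheaf_support X F \<subseteq> divisor_support X D"

end

theory Submission
  imports Defs
begin

text \<open>
  Being annihilated by \<open>\<phi>\<^sub>1\<close> and then by the restriction of \<open>\<phi>\<^sub>2\<close>, in either order, is the same
  condition on a section of \<open>\<E>\<close> as having zero image \<open>(\<phi>\<^sub>1 s, \<phi>\<^sub>2 s)\<close> in \<open>\<Q>\<^sub>1 \<oplus> \<Q>\<^sub>2\<close>.  The kernel of a
  map of sheaves of modules is computed section by section, so the three sheaves agree on the
  nose: this is \<open>iterated_ker_sheaf\<close> together with the symmetry \<open>ker_sheaf_pair_commute\<close>.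

  What remains is that the common value is a subsheaf of modules of \<open>\<E>\<close>.  A kernel is one
  (\<open>ker_sheaf_subsheaf\<close>): the only point beyond linear algebra is gluing, where a section glued from
  local sections of the kernel has an image that vanishes locally, hence vanishes because the target
  is separated.  Applied once to \<open>\<phi>\<^sub>1\<close> and once to the restriction of \<open>\<phi>\<^sub>2\<close> to \<open>V\<^sub>1\<close>, this gives
  \<open>V\<^sub>1\<^sub>2 \<subseteq> V\<^sub>1 \<subseteq> \<E>\<close>, and \<open>subsheaf_trans\<close> composes the two inclusions.
  In the second part, local freeness of \<open>V\<close> passes to \<open>V\<^sub>1\<^sub>2\<close> and \<open>V\<^sub>2\<^sub>1\<close> along the equalities.
\<close>

section \<open>Iterated kernels and kernels of pairs\<close>

lemma ker_sheaf_simps [simp]: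
  "mcarrier (ker_sheaf F G \<phi>) U = {s \<in> mcarrier F U. \<phi> U s = \<zero>\<^bsub>sec G U\<^esub>}"
  "mres (ker_sheaf F G \<phi>) = mres F"
  "add (sec (ker_sheaf F G \<phi>) U) = add (sec F U)"
  "smult (sec (ker_sheaf F G \<phi>) U) = smult (sec F U)"
  by (simp_all add: ker_sheaf_def)

lemma sec_ker_sheaf:
  "sec (ker_sheaf F G \<phi>) U = (sec F U)\<lparr>carrier := mcarrier (ker_sheaf F G \<phi>) U\<rparr>"
  by (simp add: ker_sheaf_def)

text \<open>
  The two sides agree as records, over every set of points: the restricted map is \<^const>\<open>undefined\<close>
  off the first kernel, but it is only ever evaluated on sections that already lie there.
\<close>

lemma iterated_ker_sheaf:
  "ker_sheaf (ker_sheaf F G \<phi>) H (restrict_hom (ker_sheaf F G \<phi>) \<psi>) =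
     ker_sheaf F (direct_sum G H) (pair_hom \<phi> \<psi>)"
proof -
  have "{s \<in> {s \<in> mcarrier F U. \<phi> U s = \<zero>\<^bsub>sec G U\<^esub>}.
           restrict (\<psi> U) {s \<in> mcarrier F U. \<phi> U s = \<zero>\<^bsub>sec G U\<^esub>} s = \<zero>\<^bsub>sec H U\<^esub>} =
        {s \<in> mcarrier F U. (\<phi> U s, \<psi> U s) = (\<zero>\<^bsub>sec G U\<^esub>, \<zero>\<^bsub>sec H U\<^esub>)}" for U
    by auto
  then show ?thesis
    by (simp add: ker_sheaf_def restrict_hom_def direct_sum_def pair_hom_def)
qed

lemma ker_sheaf_pair_commute:
  "ker_sheaf F (direct_sum G H) (pair_hom \<phi> \<psi>) = ker_sheaf F (direct_sum H G) (pair_hom \<psi> \<phi>)"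
  by (simp add: ker_sheaf_def direct_sum_def pair_hom_def conj_commute)

section \<open>Restriction and gluing in sheaves of modules\<close>

lemma (in abelian_group) add_idem_imp_zero:
  "x \<in> carrier G \<Longrightarrow> x \<oplus> x = x \<Longrightarrow> x = \<zero>"
  using add.r_cancel_one[of x x] by simp

context
  fixes X :: "('p, 'a) rspace" and F :: "('p, 'a, 'm) msheaf"
  assumes F: "module_sheaf X F"
begin

lemma module_sheaf_sheaf: "sheaf (base X) (mcarrier F) (mres F)"
  using F unfolding module_sheaf_def by (rule conjunct1)

lemma module_sheaf_module:
  assumes "opn X U"
  shows "module (osec X U) (sec F U)"
proof -
  have "\<forall>U. opn X U \<longrightarrow> module (osec X U) (sec F U)"
    using F unfolding module_sheaf_def by (elim conjE)
  with assms show ?thesis by (elim allE[of _ U] mp)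
qed

lemma module_sheaf_zero_closed: "opn X U \<Longrightarrow> \<zero>\<^bsub>sec F U\<^esub> \<in> mcarrier F U"
  by (intro abelian_monoid.zero_closed abelian_group.axioms(1) module.axioms(2)[OF module_sheaf_module])

lemma module_sheaf_zero_unique:
  "opn X U \<Longrightarrow> s \<in> mcarrier F U \<Longrightarrow> s \<oplus>\<^bsub>sec F U\<^esub> s = s \<Longrightarrow> s = \<zero>\<^bsub>sec F U\<^esub>"
  by (rule abelian_group.add_idem_imp_zero[OF module.axioms(2)[OF module_sheaf_module]])

lemma module_sheaf_zero_add: "opn X U \<Longrightarrow> \<zero>\<^bsub>sec F U\<^esub> \<oplus>\<^bsub>sec F U\<^esub> \<zero>\<^bsub>sec F U\<^esub> = \<zero>\<^bsub>sec F U\<^esub>"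
  by (intro abelian_monoid.l_zero abelian_group.axioms(1) module.axioms(2)[OF module_sheaf_module]
      module_sheaf_zero_closed)

lemma module_sheaf_presheaf: "presheaf (base X) (mcarrier F) (mres F)"
  using module_sheaf_sheaf unfolding sheaf_def by (rule conjunct1)

lemma mres_closed:
  assumes "opn X U" "opn X V" "V \<subseteq> U" "s \<in> mcarrier F U"
  shows "mres F U V s \<in> mcarrier F V"
proof -
  have "\<forall>U V. opn X U \<longrightarrow> opn X V \<longrightarrow> V \<subseteq> U \<longrightarrow> mres F U V \<in> mcarrier F U \<rightarrow> mcarrier F V"
    using module_sheaf_presheaf unfolding presheaf_def by (rule conjunct1)
  from this[rule_format, OF assms(1-3)] assms(4) show ?thesis by (rule funcset_mem)
qed

lemma mres_linear:
  "\<forall>U V. opn X U \<longrightarrow> opn X V \<longrightarrow> V \<subseteq> U \<longrightarrow>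
     (\<forall>s \<in> mcarrier F U. \<forall>t \<in> mcarrier F U.
        mres F U V (s \<oplus>\<^bsub>sec F U\<^esub> t) = mres F U V s \<oplus>\<^bsub>sec F V\<^esub> mres F U V t) \<and>
     (\<forall>a \<in> carrier (osec X U). \<forall>s \<in> mcarrier F U.
        mres F U V (a \<odot>\<^bsub>sec F U\<^esub> s) = ores X U V a \<odot>\<^bsub>sec F V\<^esub> mres F U V s)"
  using F unfolding module_sheaf_def by (elim conjE)

lemma mres_add:
  "opn X U \<Longrightarrow> opn X V \<Longrightarrow> V \<subseteq> U \<Longrightarrow> s \<in> mcarrier F U \<Longrightarrow> t \<in> mcarrier F U \<Longrightarrow>
     mres F U V (s \<oplus>\<^bsub>sec F U\<^esub> t) = mres F U V s \<oplus>\<^bsub>sec F V\<^esub> mres F U V t"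
  by (rule mres_linear[rule_format, THEN conjunct1, rule_format])

lemma mres_smult:
  "opn X U \<Longrightarrow> opn X V \<Longrightarrow> V \<subseteq> U \<Longrightarrow> a \<in> carrier (osec X U) \<Longrightarrow> s \<in> mcarrier F U \<Longrightarrow>
     mres F U V (a \<odot>\<^bsub>sec F U\<^esub> s) = ores X U V a \<odot>\<^bsub>sec F V\<^esub> mres F U V s"
  by (rule mres_linear[rule_format, THEN conjunct2, rule_format])

text \<open>
  Restriction maps are additive, so the image of zero is idempotent for addition; in a group this
  forces it to be zero.
\<close>

lemma mres_zero:
  assumes U: "opn X U" and V: "opn X V" "V \<subseteq> U"
  shows "mres F U V \<zero>\<^bsub>sec F U\<^esub> = \<zero>\<^bsub>sec F V\<^esub>"
proof (rule module_sheaf_zero_unique[OF V(1)])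
  show "mres F U V \<zero>\<^bsub>sec F U\<^esub> \<in> mcarrier F V"
    using mres_closed[OF U V module_sheaf_zero_closed[OF U]] .
  show "mres F U V \<zero>\<^bsub>sec F U\<^esub> \<oplus>\<^bsub>sec F V\<^esub> mres F U V \<zero>\<^bsub>sec F U\<^esub> = mres F U V \<zero>\<^bsub>sec F U\<^esub>"
    using mres_add[OF U V module_sheaf_zero_closed[OF U] module_sheaf_zero_closed[OF U]]
    by (simp add: module_sheaf_zero_add[OF U])
qed

lemma module_sheaf_glue:
  assumes "\<And>V. V \<in> \<V> \<Longrightarrow> opn X V \<and> s V \<in> mcarrier F V"
    and "\<And>V W. V \<in> \<V> \<Longrightarrow> W \<in> \<V> \<Longrightarrow> mres F V (V \<inter> W) (s V) = mres F W (V \<inter> W) (s W)"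
  shows "\<exists>!t. t \<in> mcarrier F (\<Union>\<V>) \<and> (\<forall>V \<in> \<V>. mres F (\<Union>\<V>) V t = s V)"
proof -
  have "\<forall>\<V> s. (\<forall>V \<in> \<V>. opn X V \<and> s V \<in> mcarrier F V) \<longrightarrow>
      (\<forall>V \<in> \<V>. \<forall>W \<in> \<V>. mres F V (V \<inter> W) (s V) = mres F W (V \<inter> W) (s W)) \<longrightarrow>
      (\<exists>!t. t \<in> mcarrier F (\<Union>\<V>) \<and> (\<forall>V \<in> \<V>. mres F (\<Union>\<V>) V t = s V))"
    using module_sheaf_sheaf unfolding sheaf_def by (rule conjunct2)
  note glue = this[THEN spec[of _ \<V>], THEN spec[of _ s]]
  show ?thesis
    by (rule glue[THEN mp, THEN mp]) (intro ballI assms; assumption)+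
qed

text \<open>
  The zero sections of the members of a cover form a compatible family, which both \<open>t\<close> and the
  global zero section glue; gluings are unique.
\<close>

lemma module_sheaf_locally_zero:
  assumes \<V>: "\<And>V. V \<in> \<V> \<Longrightarrow> opn X V"
    and t: "t \<in> mcarrier F (\<Union>\<V>)" "\<And>V. V \<in> \<V> \<Longrightarrow> mres F (\<Union>\<V>) V t = \<zero>\<^bsub>sec F V\<^esub>"
  shows "t = \<zero>\<^bsub>sec F (\<Union>\<V>)\<^esub>"
proof -
  have U: "opn X (\<Union>\<V>)" using \<V> by blast
  have "\<exists>!t. t \<in> mcarrier F (\<Union>\<V>) \<and> (\<forall>V \<in> \<V>. mres F (\<Union>\<V>) V t = \<zero>\<^bsub>sec F V\<^esub>)"
    by (rule module_sheaf_glue) (simp_all add: \<V> module_sheaf_zero_closed mres_zero openin_Int)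
  moreover have "\<forall>V \<in> \<V>. mres F (\<Union>\<V>) V \<zero>\<^bsub>sec F (\<Union>\<V>)\<^esub> = \<zero>\<^bsub>sec F V\<^esub>"
    using \<V> U by (simp add: mres_zero Union_upper)
  ultimately show ?thesis
    using t module_sheaf_zero_closed[OF U] by (elim ex1E) metis
qed

end

section \<open>Kernels are subsheaves\<close>

lemma module_sheaf_hom_linear:
  assumes "module_sheaf_hom X F G \<phi>" and "opn X U"
  shows "\<phi> U \<in> mcarrier F U \<rightarrow> mcarrier G U \<and>
    (\<forall>s \<in> mcarrier F U. \<forall>t \<in> mcarrier F U.
       \<phi> U (s \<oplus>\<^bsub>sec F U\<^esub> t) = \<phi> U s \<oplus>\<^bsub>sec G U\<^esub> \<phi> U t) \<and>
    (\<forall>a \<in> carrier (osec X U). \<forall>s \<in> mcarrier F U.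
       \<phi> U (a \<odot>\<^bsub>sec F U\<^esub> s) = a \<odot>\<^bsub>sec G U\<^esub> \<phi> U s)"
  using assms(1)[unfolded module_sheaf_hom_def, THEN conjunct1, THEN spec[of _ U]] assms(2)
  by (rule mp)

lemma module_sheaf_hom_closed:
  assumes "module_sheaf_hom X F G \<phi>" and "opn X U" and "s \<in> mcarrier F U"
  shows "\<phi> U s \<in> mcarrier G U"
  by (rule funcset_mem[OF module_sheaf_hom_linear[OF assms(1,2), THEN conjunct1] assms(3)])

lemma module_sheaf_hom_add:
  assumes "module_sheaf_hom X F G \<phi>" and "opn X U" and "s \<in> mcarrier F U" and "t \<in> mcarrier F U"
  shows "\<phi> U (s \<oplus>\<^bsub>sec F U\<^esub> t) = \<phi> U s \<oplus>\<^bsub>sec G U\<^esub> \<phi> U t"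
  by (rule module_sheaf_hom_linear[OF assms(1,2), THEN conjunct2, THEN conjunct1,
        rule_format, OF assms(3,4)])

lemma module_sheaf_hom_smult:
  assumes "module_sheaf_hom X F G \<phi>" and "opn X U"
    and "a \<in> carrier (osec X U)" and "s \<in> mcarrier F U"
  shows "\<phi> U (a \<odot>\<^bsub>sec F U\<^esub> s) = a \<odot>\<^bsub>sec G U\<^esub> \<phi> U s"
  by (rule module_sheaf_hom_linear[OF assms(1,2), THEN conjunct2, THEN conjunct2,
        rule_format, OF assms(3,4)])

lemma module_sheaf_hom_natural:
  assumes "module_sheaf_hom X F G \<phi>" and "opn X U" "opn X V" "V \<subseteq> U" and "s \<in> mcarrier F U"
  shows "\<phi> V (mres F U V s) = mres G U V (\<phi> U s)"
  by (rule assms(1)[unfolded module_sheaf_hom_def, THEN conjunct2, rule_format, OF assms(2-5)])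

lemma ker_sheaf_submodule:
  assumes F: "module_sheaf X F" and G: "module_sheaf X G" and \<phi>: "module_sheaf_hom X F G \<phi>"
    and U: "opn X U"
  shows "submodule (mcarrier (ker_sheaf F G \<phi>) U) (osec X U) (sec F U)"
proof -
  interpret M: module "osec X U" "sec F U" by (rule module_sheaf_module[OF F U])
  interpret N: module "osec X U" "sec G U" by (rule module_sheaf_module[OF G U])
  note hom = module_sheaf_hom_closed[OF \<phi> U] module_sheaf_hom_add[OF \<phi> U]
    module_sheaf_hom_smult[OF \<phi> U]
  have zero: "\<phi> U \<zero>\<^bsub>sec F U\<^esub> = \<zero>\<^bsub>sec G U\<^esub>"
    using hom(3)[OF M.R.zero_closed M.M.zero_closed] hom(1)[OF M.M.zero_closed] by simp
  \<comment> \<open>Negatives are multiples by \<open>-1\<close>, so linearity over the ring of functions preserves them.\<close>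
  have minus: "\<phi> U (\<ominus>\<^bsub>sec F U\<^esub> s) = \<zero>\<^bsub>sec G U\<^esub>"
    if "s \<in> mcarrier F U" "\<phi> U s = \<zero>\<^bsub>sec G U\<^esub>" for s
  proof -
    have "\<ominus>\<^bsub>sec F U\<^esub> s = (\<ominus>\<^bsub>osec X U\<^esub> \<one>\<^bsub>osec X U\<^esub>) \<odot>\<^bsub>sec F U\<^esub> s"
      using that by (simp add: M.smult_l_minus)
    then show ?thesis using hom(3)[of "\<ominus>\<^bsub>osec X U\<^esub> \<one>\<^bsub>osec X U\<^esub>" s] that by simp
  qed
  show ?thesis
    by (rule M.submoduleI) (auto simp: zero minus hom)
qed

text \<open>
  Closure under restriction and the module axioms are formal.  For gluing, local sections of the
  kernel glue in \<open>F\<close>, and the image of the result in \<open>G\<close> vanishes since it vanishes locally.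
\<close>

lemma ker_sheaf_subsheaf:
  assumes F: "module_sheaf X F" and G: "module_sheaf X G" and \<phi>: "module_sheaf_hom X F G \<phi>"
  shows "subsheaf X (ker_sheaf F G \<phi>) F"
proof -
  let ?K = "ker_sheaf F G \<phi>"
  note nat = module_sheaf_hom_natural[OF \<phi>] and cl = module_sheaf_hom_closed[OF \<phi>]
  have mres_zero_G: "mres G U V \<zero>\<^bsub>sec G U\<^esub> = \<zero>\<^bsub>sec G V\<^esub>"
    if "opn X U" "opn X V" "V \<subseteq> U" for U V
    using G that by (rule mres_zero)
  have "presheaf (base X) (mcarrier ?K) (mres ?K)"
    unfolding presheaf_def
  proof (intro conjI allI impI ballI funcsetI)
    fix U V s
    assume "opn X U" "opn X V" "V \<subseteq> U" "s \<in> mcarrier ?K U"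
    then show "mres ?K U V s \<in> mcarrier ?K V"
      by (simp add: mres_closed[OF F] nat mres_zero_G)
  qed (use module_sheaf_presheaf[OF F] in \<open>unfold presheaf_def ker_sheaf_simps, blast\<close>)+
  moreover have "\<exists>!t. t \<in> mcarrier ?K (\<Union>\<V>) \<and> (\<forall>V \<in> \<V>. mres ?K (\<Union>\<V>) V t = s V)"
    if s: "\<forall>V \<in> \<V>. opn X V \<and> s V \<in> mcarrier ?K V"
      and compat: "\<forall>V \<in> \<V>. \<forall>W \<in> \<V>. mres ?K V (V \<inter> W) (s V) = mres ?K W (V \<inter> W) (s W)"
    for \<V> s
  proof -
    have U: "opn X (\<Union>\<V>)" using s by blast
    have ex1: "\<exists>!t. t \<in> mcarrier F (\<Union>\<V>) \<and> (\<forall>V \<in> \<V>. mres F (\<Union>\<V>) V t = s V)"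
      by (rule module_sheaf_glue[OF F]) (use s compat in auto)
    then obtain t where t: "t \<in> mcarrier F (\<Union>\<V>)" "\<forall>V \<in> \<V>. mres F (\<Union>\<V>) V t = s V"
      by blast
    have "\<phi> (\<Union>\<V>) t = \<zero>\<^bsub>sec G (\<Union>\<V>)\<^esub>"
    proof (rule module_sheaf_locally_zero[OF G])
      fix V assume V: "V \<in> \<V>"
      then have "mres G (\<Union>\<V>) V (\<phi> (\<Union>\<V>) t) = \<phi> V (s V)"
        using nat[OF U, of V t] s t by (simp add: Union_upper)
      then show "mres G (\<Union>\<V>) V (\<phi> (\<Union>\<V>) t) = \<zero>\<^bsub>sec G V\<^esub>"
        using s V by simp
    qed (use s cl[OF U t(1)] in auto)
    with t ex1 show ?thesis by (intro ex1I[of _ t]) auto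
  qed
  ultimately have "sheaf (base X) (mcarrier ?K) (mres ?K)"
    unfolding sheaf_def by blast
  moreover have sub: "submodule (mcarrier ?K U) (osec X U) (sec F U)" if "opn X U" for U
    using ker_sheaf_submodule[OF F G \<phi> that] .
  moreover have "module (osec X U) (sec ?K U)" if "opn X U" for U
    using submodule.submodule_is_module[OF sub module_sheaf_module[OF F]] that
    by (subst sec_ker_sheaf)
  ultimately have "module_sheaf X ?K"
    unfolding module_sheaf_def
    by (intro conjI allI impI ballI) (simp_all add: mres_add[OF F] mres_smult[OF F])
  then show ?thesis
    unfolding subsheaf_def
    by (intro conjI allI impI sub sec_ker_sheaf ker_sheaf_simps(2))
qed

section \<open>Transitivity and the kernel of a pair\<close>

lemma subsheaf_module_sheaf: "subsheaf X G F \<Longrightarrow> module_sheaf X G"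
  by (simp only: subsheaf_def)

lemma subsheaf_mres: "subsheaf X G F \<Longrightarrow> mres G = mres F"
  by (simp only: subsheaf_def)

lemma subsheaf_submodule:
  assumes "subsheaf X G F" and "opn X U"
  shows "submodule (mcarrier G U) (osec X U) (sec F U)"
  by (rule assms(1)[unfolded subsheaf_def, THEN conjunct2, THEN conjunct2, THEN spec[of _ U],
        THEN mp, OF assms(2), THEN conjunct1])

lemma subsheaf_sec:
  assumes "subsheaf X G F" and "opn X U"
  shows "sec G U = (sec F U)\<lparr>carrier := mcarrier G U\<rparr>"
  by (rule assms(1)[unfolded subsheaf_def, THEN conjunct2, THEN conjunct2, THEN spec[of _ U],
        THEN mp, OF assms(2), THEN conjunct2])

text \<open>
  On each open set, \<open>H\<close> is a module whose operations are those of \<open>G\<close>, hence those of \<open>F\<close>, and a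
  subset that is a module under the ambient operations is a submodule.
\<close>

lemma subsheaf_trans:
  assumes HG: "subsheaf X H G" and GF: "subsheaf X G F" and F: "module_sheaf X F"
  shows "subsheaf X H F"
proof -
  have "submodule (mcarrier H U) (osec X U) (sec F U) \<and>
        sec H U = (sec F U)\<lparr>carrier := mcarrier H U\<rparr>" if U: "opn X U" for U
  proof -
    interpret M: module "osec X U" "sec F U" by (rule module_sheaf_module[OF F U])
    note HG_eq = subsheaf_sec[OF HG U] and G = subsheaf_sec[OF GF U]
    have "(sec G U)\<lparr>carrier := C\<rparr> = (sec F U)\<lparr>carrier := C\<rparr>" for C
      by (subst G) simp
    with HG_eq have H: "sec H U = (sec F U)\<lparr>carrier := mcarrier H U\<rparr>"
      by (rule trans)
    interpret N: module "osec X U" "sec G U"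
      by (rule module_sheaf_module[OF subsheaf_module_sheaf[OF GF] U])
    have "mcarrier H U \<subseteq> mcarrier G U" "mcarrier G U \<subseteq> mcarrier F U"
      using N.submoduleE(1)[OF subsheaf_submodule[OF HG U]]
        M.submoduleE(1)[OF subsheaf_submodule[OF GF U]] .
    then have "mcarrier H U \<subseteq> mcarrier F U" by (rule subset_trans)
    moreover have "module (osec X U) ((sec F U)\<lparr>carrier := mcarrier H U\<rparr>)"
      using module_sheaf_module[OF subsheaf_module_sheaf[OF HG] U] by (rule H[THEN subst])
    ultimately show ?thesis using H M.module_incl_imp_submodule by blast
  qed
  moreover have "mres H = mres F"
    using subsheaf_mres[OF HG] subsheaf_mres[OF GF] by (rule trans)
  ultimately show ?thesis
    using subsheaf_module_sheaf[OF HG] unfolding subsheaf_def by (intro conjI allI impI) auto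
qed

text \<open>
  The restricted map agrees with \<open>\<psi>\<close> only on the kernel, so each identity satisfied by \<open>\<psi>\<close> transfers
  once the sums, multiples and restrictions in it are known to stay in the kernel.
\<close>

lemma module_sheaf_hom_restrict_ker:
  assumes F: "module_sheaf X F" and G: "module_sheaf X G"
    and \<phi>: "module_sheaf_hom X F G \<phi>" and \<psi>: "module_sheaf_hom X F H \<psi>"
  shows "module_sheaf_hom X (ker_sheaf F G \<phi>) H (restrict_hom (ker_sheaf F G \<phi>) \<psi>)"
proof -
  let ?K = "ker_sheaf F G \<phi>"
  have K: "module_sheaf X ?K"
    by (rule subsheaf_module_sheaf[OF ker_sheaf_subsheaf[OF F G \<phi>]])
  have restr: "restrict_hom ?K \<psi> U s = \<psi> U s" if "s \<in> mcarrier ?K U" for U s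
    using that by (simp add: restrict_hom_def)
  have KF: "s \<in> mcarrier F U" if "s \<in> mcarrier ?K U" for U s
    using that by simp
  have add: "s \<oplus>\<^bsub>sec F U\<^esub> t \<in> mcarrier ?K U"
    and smult: "a \<in> carrier (osec X U) \<Longrightarrow> a \<odot>\<^bsub>sec F U\<^esub> s \<in> mcarrier ?K U"
    if "opn X U" "s \<in> mcarrier ?K U" "t \<in> mcarrier ?K U" for U s t a
    using module.submoduleE(4,5)[OF module_sheaf_module[OF F that(1)]
        ker_sheaf_submodule[OF F G \<phi> that(1)]] that by blast+
  show ?thesis
    unfolding module_sheaf_hom_def
  proof (intro conjI allI impI ballI funcsetI)
    fix U s assume U: "opn X U" and s: "s \<in> mcarrier ?K U"
    show "restrict_hom ?K \<psi> U s \<in> mcarrier H U"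
      unfolding restr[OF s] by (rule module_sheaf_hom_closed[OF \<psi> U KF[OF s]])
    show "restrict_hom ?K \<psi> U (s \<oplus>\<^bsub>sec ?K U\<^esub> t) =
        restrict_hom ?K \<psi> U s \<oplus>\<^bsub>sec H U\<^esub> restrict_hom ?K \<psi> U t" if t: "t \<in> mcarrier ?K U" for t
      unfolding ker_sheaf_simps(3) restr[OF s] restr[OF t] restr[OF add[OF U s t]]
      by (rule module_sheaf_hom_add[OF \<psi> U KF[OF s] KF[OF t]])
    show "restrict_hom ?K \<psi> U (a \<odot>\<^bsub>sec ?K U\<^esub> s) = a \<odot>\<^bsub>sec H U\<^esub> restrict_hom ?K \<psi> U s"
      if a: "a \<in> carrier (osec X U)" for a
      unfolding ker_sheaf_simps(4) restr[OF s] restr[OF smult[OF U s s a]]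
      by (rule module_sheaf_hom_smult[OF \<psi> U a KF[OF s]])
    fix V assume V: "opn X V" "V \<subseteq> U"
    show "restrict_hom ?K \<psi> V (mres ?K U V s) = mres H U V (restrict_hom ?K \<psi> U s)"
      unfolding restr[OF s] ker_sheaf_simps(2)
        restr[OF mres_closed[OF K U V s, unfolded ker_sheaf_simps(2)]]
      by (rule module_sheaf_hom_natural[OF \<psi> U V KF[OF s]])
  qed
qed

text \<open>
  The kernel of the pair is reached through the iterated kernel, so that the sheaf property is used
  for each of the two targets separately instead of for their direct sum.
\<close>

lemma ker_sheaf_pair_subsheaf:
  assumes F: "module_sheaf X F" and G: "module_sheaf X G" and H: "module_sheaf X H"
    and \<phi>: "module_sheaf_hom X F G \<phi>" and \<psi>: "module_sheaf_hom X F H \<psi>"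
  shows "subsheaf X (ker_sheaf F (direct_sum G H) (pair_hom \<phi> \<psi>)) F"
proof -
  let ?K = "ker_sheaf F G \<phi>"
  have KF: "subsheaf X ?K F" by (rule ker_sheaf_subsheaf[OF F G \<phi>])
  then have "module_sheaf X ?K" by (rule subsheaf_module_sheaf)
  then have "subsheaf X (ker_sheaf ?K H (restrict_hom ?K \<psi>)) ?K"
    using ker_sheaf_subsheaf H module_sheaf_hom_restrict_ker[OF F G \<phi> \<psi>] by blast
  then show ?thesis
    using subsheaf_trans[OF _ KF F] by (simp add: iterated_ker_sheaf)
qed

section \<open>Elementary transforms commute\<close>

theorem lemma3p2:
  fixes X :: "('p, 'a) rspace"
    and \<kappa> :: "'k::alg_closed_field \<Rightarrow> 'a"
    and E :: "('p, 'a, 'm) msheaf"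
    and D1 D2 :: "'p set \<Rightarrow> 'a set"
    and Q1 :: "('p, 'a, 'q1) msheaf"
    and Q2 :: "('p, 'a, 'q2) msheaf"
    and \<phi>1 :: "'p set \<Rightarrow> 'm \<Rightarrow> 'q1"
    and \<phi>2 :: "'p set \<Rightarrow> 'm \<Rightarrow> 'q2"
    and V1 V2 V12 V21 V :: "('p, 'a, 'm) msheaf"
  assumes "smooth_projective_variety X \<kappa>"
    and "vector_bundle X E"
    and "effective_cartier X D1" and "effective_cartier X D2"
    and "divisor_support X D1 \<inter> divisor_support X D2 = {}"
    and "coherent X Q1" and "torsion_sheaf X Q1" and "\<not> zero_sheaf X Q1"
    and "supported_on X Q1 D1"
    and "coherent X Q2" and "torsion_sheaf X Q2" and "\<not> zero_sheaf X Q2"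
    and "supported_on X Q2 D2"
    and "module_sheaf_epi X E Q1 \<phi>1"
    and "module_sheaf_epi X E Q2 \<phi>2"
  defines "V1 \<equiv> ker_sheaf E Q1 \<phi>1"
    and "V2 \<equiv> ker_sheaf E Q2 \<phi>2"
    and "V12 \<equiv> ker_sheaf V1 Q2 (restrict_hom V1 \<phi>2)"
    and "V21 \<equiv> ker_sheaf V2 Q1 (restrict_hom V2 \<phi>1)"
    and "V \<equiv> ker_sheaf E (direct_sum Q1 Q2) (pair_hom \<phi>1 \<phi>2)"
  shows "(subsheaf X V12 E \<and> subsheaf X V21 E \<and> subsheaf X V E \<and> V12 = V21 \<and> V21 = V) \<and>
    (locally_free X V1 \<and> locally_free X V2 \<and> locally_free X V \<longrightarrow>
       subbundle X V12 E \<and> subbundle X V21 E \<and> subbundle X V E \<and> V12 = V21 \<and> V21 = V)"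
proof -
  have sheaves: "module_sheaf X E" "module_sheaf X Q1" "module_sheaf X Q2"
    using assms(2,6,10) by (simp_all add: locally_free_def coherent_def)
  have homs: "module_sheaf_hom X E Q1 \<phi>1" "module_sheaf_hom X E Q2 \<phi>2"
    using assms(14,15) by (simp_all add: module_sheaf_epi_def)
  have "V12 = V"
    unfolding V12_def V1_def V_def by (rule iterated_ker_sheaf)
  moreover have "V21 = V"
    unfolding V21_def V2_def V_def
    by (rule iterated_ker_sheaf[THEN trans], rule ker_sheaf_pair_commute)
  moreover have "subsheaf X V E"
    unfolding V_def by (rule ker_sheaf_pair_subsheaf[OF sheaves homs])
  ultimately show ?thesis by (simp add: subbundle_def)
qed

end
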